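(* Let $q\ge 3$ be an integer, let $\chi$ be a Dirichlet character modulo $q$, and let $s>1$ be an integer such that $s$ and $\chi$ have different parity, i.e. $\chi(-1)=(-1)^{s+1}$. Then \[ L(s,\chi)=\frac{(-i)^{(s+1)\bmod 2}}{q}\sum_{j=1}^{q}G(j,\chi)\sum_{n=1}^{\infty}\frac{\sin^{(s+1)\bmod 2}\!\left(\frac{2\pi n j}{q}\right)\cos^{s\bmod 2}\!\left(\frac{2\pi n j}{q}\right)}{n^s}. \] Here $r\bmod 2\in\{0,1\}$ denotes the remainder of $r$ upon division by $2$. Concretely: if $s$ is odd (so $\chi$ is even), $L(s,\chi)=\frac1q\sum_{j=1}^q G(j,\chi)\sum_{n\ge1}\frac{\cos(2\pi nj/q)}{n^s}$; if $s$ is even (so $\chi$ is odd), $L(s,\chi)=-\frac{i}{q}\sum_{j=1}^q G(j,\chi)\sum_{n\ge1}\frac{\sin(2\pi nj/q)}{n^s}$.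
   Context: For a Dirichlet character $\chi$ modulo $q$, $L(s,\chi)=\sum_{n=1}^\infty \chi(n)n^{-s}$. The Gauss sum attached to $\chi$ is $G(z,\chi)=\sum_{k=0}^{q-1}\chi(k)e^{2\pi i k z/q}$ for an integer $z$. A character is even if $\chi(-1)=1$ and odd if $\chi(-1)=-1$; "$s$ and $\chi$ have the same parity" means $\chi(-1)=(-1)^s$. *)

theory Defs
  imports "HOL-Analysis.Analysis"
begin

text \<open>
  Dirichlet characters modulo \<open>q\<close> are taken in their extension by zero to all integers,
  so that \<open>chi (-1)\<close> is meaningful. Taking \<open>a = b = 1\<close> in the multiplicativity
  condition, together with \<open>chi 1 \<noteq> 0\<close>, gives \<open>chi 1 = 1\<close>.
\<close>

definition dirichlet_character :: "nat \<Rightarrow> (int \<Rightarrow> complex) \<Rightarrow> bool" where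
  "dirichlet_character q chi \<longleftrightarrow>
     (\<forall>a b. chi (a * b) = chi a * chi b) \<and>
     (\<forall>a. chi (a + int q) = chi a) \<and>
     (\<forall>a. chi a \<noteq> 0 \<longleftrightarrow> coprime a (int q))"

text \<open>
  The Dirichlet series itself, not its analytic continuation: the value is meaningful only where
  the series converges, in particular for \<open>Re s > 1\<close>.
\<close>

definition dirichlet_L :: "complex \<Rightarrow> (int \<Rightarrow> complex) \<Rightarrow> complex" where
  "dirichlet_L s chi = (\<Sum>n. chi (int (Suc n)) * of_nat (Suc n) powr (-s))"

definition gauss_sum :: "nat \<Rightarrow> int \<Rightarrow> (int \<Rightarrow> complex) \<Rightarrow> complex" where
  "gauss_sum q z chi =
     (\<Sum>k<q. chi (int k) * exp (2 * of_real pi * \<i> * of_nat k * of_int z / of_nat q))"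

end

theory Submission
  imports Defs
begin

text \<open>
  The Gauss sums \<open>j \<mapsto> G(j, \<chi>)\<close> are the discrete Fourier transform of \<open>\<chi>\<close>, so Fourier inversion
  on \<open>\<int>/q\<close> gives \<open>\<Sum>\<^sub>j G(j, \<chi>) e\<^bsup>-2\<pi>inj/q\<^esup> = q \<chi>(n)\<close>. Combining the
  identities for \<open>n\<close> and \<open>-n\<close>, the parity of \<open>\<chi>\<close> selects the cosine or the sine, and it remains to
  divide by \<open>n\<^sup>s\<close> and sum over \<open>n\<close>.
\<close>

lemma exp_root_of_unity_eq_1_iff:
  fixes m :: int and q :: nat
  assumes "q > 0"
  shows "exp (2 * of_real pi * \<i> * of_int m / of_nat q) = 1 \<longleftrightarrow> int q dvd m"
proof -
  have "exp (2 * of_real pi * \<i> * of_int m / of_nat q) = 1 \<longleftrightarrow>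
      (\<exists>k::int. 2 * pi * of_int m / of_nat q = of_int (2 * k) * pi)"
    by (simp add: exp_eq_1 Re_divide_of_nat Im_divide_of_nat)
  also have "\<dots> \<longleftrightarrow> (\<exists>k::int. real_of_int m = real_of_int (int q * k))"
    using assms by (intro ex_cong1) (auto simp: field_simps)
  also have "\<dots> \<longleftrightarrow> int q dvd m"
    unfolding of_int_eq_iff dvd_def ..
  finally show ?thesis .
qed

text \<open>The terms are powers of one root of unity \<open>w\<close> with
  \<open>w ^ q = 1\<close>. For \<open>w \<noteq> 1\<close> the geometric sum has numerator
  \<open>w - w ^ (q + 1)\<close>, which vanishes; for \<open>w = 1\<close> all \<open>q\<close>
  terms are 1.\<close>

lemma sum_roots_of_unity:
  fixes m :: int and q :: nat
  assumes "q > 0"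
  shows "(\<Sum>j = 1..q. exp (2 * of_real pi * \<i> * of_int m * of_nat j / of_nat q)) =
    (if int q dvd m then of_nat q else (0 :: complex))"
proof -
  define w :: complex where "w = exp (2 * of_real pi * \<i> * of_int m / of_nat q)"
  have pow: "exp (2 * of_real pi * \<i> * of_int m * of_nat j / of_nat q) = w ^ j" for j
    unfolding w_def exp_of_nat_mult [symmetric] by (simp add: mult_ac)
  have "w ^ q = exp (2 * of_real pi * \<i> * of_int m)"
    using assms pow [of q] by simp
  then have wq: "w ^ q = 1"
    \<comment> \<open>The criterion is taken with modulus 1, which divides every integer.\<close>
    using exp_root_of_unity_eq_1_iff [of 1 m] by simp
  have "(\<Sum>j = 1..q. w ^ j) = (if w = 1 then of_nat q else 0)"
    using assms wq by (auto simp: sum_gp)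
  then show ?thesis
    using exp_root_of_unity_eq_1_iff [OF assms, of m] by (simp only: pow w_def)
qed

lemma periodic_eq_mod:
  fixes f :: "int \<Rightarrow> 'a"
  assumes "\<And>a. f (a + int q) = f a"
  shows "f (n mod int q) = f n"
proof -
  have nat: "f (a + int k * int q) = f a" for a k
    by (induction k) (simp, metis add.assoc add.commute assms distrib_right mult_1 of_nat_Suc)
  have "f (a + k * int q) = f a" for a k
  proof (cases "k \<ge> 0")
    case True
    then show ?thesis using nat [of a "nat k"] by simp
  next
    case False
    \<comment> \<open>Shifting up by \<open>- k\<close> periods from the base point
      \<open>a + k * int q\<close> leads back to \<open>a\<close>.\<close>
    then show ?thesis using nat [of "a + k * int q" "nat (- k)"] by simp
  qed
  from this [of "n mod int q" "n div int q"] show ?thesis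
    by simp
qed

text \<open>Expanding the Gauss sum and summing over \<open>j\<close> first leaves a full sum of
  roots of unity with frequency \<open>k - n\<close>, which detects \<open>k\<close> congruent to
  \<open>n\<close> modulo \<open>q\<close>.\<close>

lemma gauss_sum_inversion:
  assumes "q > 0" and periodic: "\<And>a. f (a + int q) = f a"
  shows "(\<Sum>j = 1..q. gauss_sum q (int j) f *
      exp (- (2 * of_real pi * \<i> * of_int n * of_nat j / of_nat q))) = of_nat q * f n"
proof -
  have "(\<Sum>j = 1..q. gauss_sum q (int j) f *
        exp (- (2 * of_real pi * \<i> * of_int n * of_nat j / of_nat q))) =
      (\<Sum>j = 1..q. \<Sum>k<q. f (int k) *
        exp (2 * of_real pi * \<i> * of_int (int k - n) * of_nat j / of_nat q))"
    unfolding gauss_sum_def sum_distrib_right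
    by (intro sum.cong refl)
      (simp add: mult.assoc exp_add [symmetric] diff_divide_distrib [symmetric] algebra_simps)
  also have "\<dots> = (\<Sum>k<q. f (int k) *
      (\<Sum>j = 1..q. exp (2 * of_real pi * \<i> * of_int (int k - n) * of_nat j / of_nat q)))"
    by (subst sum.swap) (simp only: sum_distrib_left)
  also have "\<dots> = (\<Sum>k<q. f (int k) * (if int q dvd int k - n then of_nat q else 0))"
    by (simp only: sum_roots_of_unity [OF \<open>q > 0\<close>])
  \<comment> \<open>The range \<open>k < q\<close> contains exactly one representative of the
    residue class of \<open>n\<close>.\<close>
  also have "\<dots> = (\<Sum>k<q. if k = nat (n mod int q) then f (int k) * of_nat q else 0)"
  proof (intro sum.cong refl)
    fix k assume "k \<in> {..<q}"
    then have "int q dvd int k - n \<longleftrightarrow> k = nat (n mod int q)"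
      using assms(1) by (auto simp: mod_eq_dvd_iff [symmetric] nat_eq_iff)
    then show "f (int k) * (if int q dvd int k - n then of_nat q else 0) =
        (if k = nat (n mod int q) then f (int k) * of_nat q else 0)"
      by simp
  qed
  also have "\<dots> = f (n mod int q) * of_nat q"
    using assms(1) by (simp add: nat_less_iff)
  finally show ?thesis
    using periodic_eq_mod [of f q n, OF periodic] by (simp add: mult.commute)
qed

text \<open>By Euler's formula the cosine averages the exponentials for \<open>n\<close> and
  \<open>- n\<close>, so inversion returns \<open>q\<close> times the even part of
  \<open>f\<close>.\<close>

lemma gauss_sum_cos:
  assumes "q > 0" and "\<And>a. f (a + int q) = f a"
  shows "(\<Sum>j = 1..q. gauss_sum q (int j) f * of_real (cos (2 * pi * real n * real j / real q))) =
    of_nat q * (f (int n) + f (- int n)) / 2"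
proof -
  have "(\<Sum>j = 1..q. gauss_sum q (int j) f * of_real (cos (2 * pi * real n * real j / real q))) =
      ((\<Sum>j = 1..q. gauss_sum q (int j) f *
        exp (- (2 * of_real pi * \<i> * of_int (int n) * of_nat j / of_nat q))) +
      (\<Sum>j = 1..q. gauss_sum q (int j) f *
        exp (- (2 * of_real pi * \<i> * of_int (- int n) * of_nat j / of_nat q)))) / 2"
    unfolding sum.distrib [symmetric] sum_divide_distrib
    by (intro sum.cong refl) (simp add: cos_of_real [symmetric] cos_exp_eq algebra_simps)
  then show ?thesis
    unfolding gauss_sum_inversion [of q f, OF assms] by (simp add: algebra_simps)
qed

text \<open>The value is \<open>\<i> * q\<close> times the odd part of \<open>f\<close>. The term
  \<open>f (- int n)\<close> comes with the plus sign because inversion pairs \<open>n\<close> with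
  the exponential of negative frequency.\<close>

lemma gauss_sum_sin:
  assumes "q > 0" and "\<And>a. f (a + int q) = f a"
  shows "(\<Sum>j = 1..q. gauss_sum q (int j) f * of_real (sin (2 * pi * real n * real j / real q))) =
    of_nat q * (f (- int n) - f (int n)) / (2 * \<i>)"
proof -
  have "(\<Sum>j = 1..q. gauss_sum q (int j) f * of_real (sin (2 * pi * real n * real j / real q))) =
      ((\<Sum>j = 1..q. gauss_sum q (int j) f *
        exp (- (2 * of_real pi * \<i> * of_int (- int n) * of_nat j / of_nat q))) -
      (\<Sum>j = 1..q. gauss_sum q (int j) f *
        exp (- (2 * of_real pi * \<i> * of_int (int n) * of_nat j / of_nat q)))) / (2 * \<i>)"
    unfolding sum_subtractf [symmetric] sum_divide_distrib
    by (intro sum.cong refl)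
      (simp add: sin_of_real [symmetric] sin_exp_eq right_diff_distrib diff_divide_distrib mult_ac)
  then show ?thesis
    unfolding gauss_sum_inversion [of q f, OF assms] by (simp add: algebra_simps)
qed

theorem theorem1:
  fixes q s :: nat and chi :: "int \<Rightarrow> complex"
  assumes "q \<ge> 3"
    and "dirichlet_character q chi"
    and "s > 1"
    and "chi (-1) = (-1) ^ (s + 1)"
  shows "dirichlet_L (of_nat s) chi =
    (-\<i>) ^ ((s + 1) mod 2) / of_nat q *
    (\<Sum>j = 1..q. gauss_sum q (int j) chi *
       complex_of_real (\<Sum>n. sin (2 * pi * real (Suc n) * real j / real q) ^ ((s + 1) mod 2) *
                            cos (2 * pi * real (Suc n) * real j / real q) ^ (s mod 2) /
                            real (Suc n) ^ s))"
proof -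
  \<comment> \<open>One of the two exponents is 0 and the other is 1, so \<open>T\<close> is a sine
    for even \<open>s\<close> and a cosine for odd \<open>s\<close>. The common form lets the
    analytic part below treat both parities at once.\<close>
  define T where "T n j = sin (2 * pi * real (Suc n) * real j / real q) ^ ((s + 1) mod 2) *
    cos (2 * pi * real (Suc n) * real j / real q) ^ (s mod 2)" for n j
  have "q > 0"
    using assms(1) by simp
  have periodic: "\<And>a. chi (a + int q) = chi a" and mult: "\<And>a b. chi (a * b) = chi a * chi b"
    using assms(2) by (auto simp: dirichlet_character_def)
  have neg: "chi (- int n) = (-1) ^ (s + 1) * chi (int n)" for n
    using mult [of "-1" "int n"] assms(4) by simp
  \<comment> \<open>For even \<open>s\<close>, \<open>chi\<close> equals its odd part and the
    prefactor \<open>-\<i>\<close> cancels the \<open>\<i>\<close> from the sine sum; for odd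
    \<open>s\<close>, \<open>chi\<close> equals its even part and the prefactor is 1.\<close>
  have inversion: "(-\<i>) ^ ((s + 1) mod 2) * (\<Sum>j = 1..q. gauss_sum q (int j) chi * of_real (T n j)) =
      of_nat q * chi (int (Suc n))" for n
  proof (cases "even s")
    case True
    then have "(s + 1) mod 2 = 1" "s mod 2 = 0" by presburger+
    then show ?thesis
      using gauss_sum_sin [of q chi "Suc n", OF \<open>q > 0\<close> periodic] True neg [of "Suc n"]
      by (simp add: T_def del: of_nat_Suc)
  next
    case False
    then have "(s + 1) mod 2 = 0" "s mod 2 = 1" by presburger+
    then show ?thesis
      using gauss_sum_cos [of q chi "Suc n", OF \<open>q > 0\<close> periodic] False neg [of "Suc n"]
      by (simp add: T_def del: of_nat_Suc)
  qed
  \<comment> \<open>Since \<open>T\<close> is bounded by 1, the series of \<open>1 / n ^ s\<close>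
    with \<open>s > 1\<close> dominates.\<close>
  have summable: "summable (\<lambda>n. T n j / real (Suc n) ^ s)" for j
  proof (rule summable_comparison_test')
    show "summable (\<lambda>n. inverse (real (Suc n) ^ s))"
      using inverse_power_summable [of s, where 'a = real] assms(3)
      by (subst summable_Suc_iff) simp
    show "norm (T n j / real (Suc n) ^ s) \<le> inverse (real (Suc n) ^ s)" if "n \<ge> 0" for n
    proof -
      have "\<bar>T n j\<bar> \<le> 1 * 1"
        unfolding T_def abs_mult power_abs by (intro mult_mono power_le_one) auto
      then show ?thesis
        by (simp add: abs_mult divide_inverse mult_left_le_one_le del: of_nat_Suc)
    qed
  qed
  have "(-\<i>) ^ ((s + 1) mod 2) / of_nat q *
      (\<Sum>j = 1..q. gauss_sum q (int j) chi * complex_of_real (\<Sum>n. T n j / real (Suc n) ^ s)) =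
      (-\<i>) ^ ((s + 1) mod 2) / of_nat q *
      (\<Sum>j = 1..q. \<Sum>n. gauss_sum q (int j) chi * of_real (T n j / real (Suc n) ^ s))"
    by (simp only: suminf_of_real [OF summable] suminf_mult [OF summable_of_real [OF summable]])
  also have "\<dots> = (\<Sum>n. (-\<i>) ^ ((s + 1) mod 2) / of_nat q *
      (\<Sum>j = 1..q. gauss_sum q (int j) chi * of_real (T n j / real (Suc n) ^ s)))"
    \<comment> \<open>The sum over \<open>j\<close> is finite, so convergence of the series for each
      \<open>j\<close> justifies the exchange.\<close>
    by (subst suminf_sum [symmetric], intro summable_mult summable_of_real summable,
        subst suminf_mult, intro summable_sum summable_mult summable_of_real summable) (rule refl)
  also have "\<dots> = (\<Sum>n. chi (int (Suc n)) * of_nat (Suc n) powr (- of_nat s))"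
  proof (rule suminf_cong)
    fix n
    have "(-\<i>) ^ ((s + 1) mod 2) / of_nat q *
        (\<Sum>j = 1..q. gauss_sum q (int j) chi * of_real (T n j / real (Suc n) ^ s)) =
        (-\<i>) ^ ((s + 1) mod 2) * (\<Sum>j = 1..q. gauss_sum q (int j) chi * of_real (T n j)) /
        of_nat q / of_nat (Suc n) ^ s"
      by (simp add: sum_divide_distrib [symmetric] del: of_nat_Suc)
    also have "\<dots> = chi (int (Suc n)) / of_nat (Suc n) ^ s"
      unfolding inversion using \<open>q > 0\<close> by simp
    also have "\<dots> = chi (int (Suc n)) * of_nat (Suc n) powr (- of_nat s)"
      \<comment> \<open>The base \<open>Suc n\<close> is nonzero, so the complex power agrees with
        the ordinary one.\<close>
      by (simp add: powr_minus divide_inverse powr_nat' del: of_nat_Suc)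
    finally show "(-\<i>) ^ ((s + 1) mod 2) / of_nat q *
        (\<Sum>j = 1..q. gauss_sum q (int j) chi * of_real (T n j / real (Suc n) ^ s)) =
        chi (int (Suc n)) * of_nat (Suc n) powr (- of_nat s)" .
  qed
  finally show ?thesis
    unfolding T_def dirichlet_L_def ..
qed

end
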